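(* Let $n\geqslant 2$ and let $C_n$ be a caterpillar graph with $n$ spine vertices and a total of $L(C_n)$ leaves. If there is a non-zero modified balanced domination function (MBDF) $f$ on $C_n$, then $L(C_n)\equiv 3n-2 \pmod 4$.
   Context: For a simple undirected finite graph $G$ and $v\in V(G)$, the closed neighborhood is $N_G[v]=\{u\in V(G): uv\in E(G)\}\cup\{v\}$. A function $f\colon V(G)\to\{-1,0,1\}$ is a balanced domination function (BDF) on $G$ if $\sum_{u\in N_G[v]} f(u)=0$ for every $v\in V(G)$. A caterpillar graph $C_n$ with $n$ spine vertices consists of a path $a_1,a_2,\dotsc,a_n$ (the spine, with edges $a_ia_{i+1}$ for $1\leqslant i\leqslant n-1$), where each spine vertex $a_i$ has $l_i\geqslant 0$ leaves attached, denoted $a_{i,1},\dotsc,a_{i,l_i}$ if $l_i\geqslant 1$, each adjacent only to $a_i$. (Here $n$ is the number of spine vertices, and the leaves counted are the attached vertices $a_{i,j}$.) The total number of leaves is $L(C_n)=\sum_{i=1}^n l_i$. A function $f\colon V(C_n)\to\{-1,0,1\}$ is a modified balanced domination function (MBDF) on $C_n$ if $f$ is a BDF on $C_n$ such that $f(a_i)\in\{-1,1\}$ for every spine vertex $a_i$ with $l_i\neq 1$. Non-zero means not identically zero. *)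

theory Defs
  imports "Graph_Theory.Pair_Digraph" "HOL-Number_Theory.Cong"
begin

text \<open>A finite simple undirected graph is a \<^locale>\<open>pair_graph\<close>: finitely many vertices and
  a symmetric loop-free arc set, the edge $uv$ being the two arcs \<open>(u, v)\<close> and \<open>(v, u)\<close>.\<close>

definition closed_nbhd :: "'a pair_pre_digraph \<Rightarrow> 'a \<Rightarrow> 'a set" where
  "closed_nbhd G v = {u \<in> pverts G. (u, v) \<in> parcs G} \<union> {v}"

text \<open>Functions on the vertex set are total functions on the vertex type; values outside
  \<open>pverts G\<close> are irrelevant.\<close>

definition bdf :: "'a pair_pre_digraph \<Rightarrow> ('a \<Rightarrow> int) \<Rightarrow> bool" where
  "bdf G f \<longleftrightarrow>
     (\<forall>v \<in> pverts G. f v \<in> {-1, 0, 1}) \<and>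
     (\<forall>v \<in> pverts G. (\<Sum>u \<in> closed_nbhd G v. f u) = 0)"

text \<open>\<open>Spine i\<close> is $a_i$ and \<open>Pendant i j\<close> is $a_{i,j}$; indices start at 1.\<close>

datatype cat_vertex = Spine nat | Pendant nat nat

definition caterpillar :: "nat \<Rightarrow> (nat \<Rightarrow> nat) \<Rightarrow> cat_vertex pair_pre_digraph" where
  "caterpillar n l =
     (let E = {(Spine i, Spine (i + 1)) | i. 1 \<le> i \<and> i + 1 \<le> n} \<union>
              {(Spine i, Pendant i j) | i j. i \<in> {1..n} \<and> j \<in> {1..l i}}
      in \<lparr> pverts = {Spine i | i. i \<in> {1..n}} \<union>
                    {Pendant i j | i j. i \<in> {1..n} \<and> j \<in> {1..l i}},
           parcs = E \<union> E\<inverse> \<rparr>)"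

lemma pair_graph_caterpillar: "pair_graph (caterpillar n l)"
proof
  have "pverts (caterpillar n l) =
      Spine ` {1..n} \<union> (\<lambda>(i, j). Pendant i j) ` (SIGMA i:{1..n}. {1..l i})"
    by (auto simp: caterpillar_def Let_def)
  then show fin: "finite (pverts (caterpillar n l))"
    by simp
  have sub: "parcs (caterpillar n l) \<subseteq> pverts (caterpillar n l) \<times> pverts (caterpillar n l)"
    by (auto simp: caterpillar_def Let_def)
  then show "finite (parcs (caterpillar n l))"
    using fin by (meson finite_SigmaI finite_subset)
  show "fst e \<in> pverts (caterpillar n l)" "snd e \<in> pverts (caterpillar n l)"
    if "e \<in> parcs (caterpillar n l)" for e
    using sub that by auto
  show "fst e \<noteq> snd e" if "e \<in> parcs (caterpillar n l)" for e
    using that by (auto simp: caterpillar_def Let_def)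
  show "symmetric (with_proj (caterpillar n l))"
    by (auto simp: symmetric_def arcs_ends_def arc_to_ends_def sym_def caterpillar_def Let_def)
qed

definition num_leaves :: "nat \<Rightarrow> (nat \<Rightarrow> nat) \<Rightarrow> nat" where
  "num_leaves n l = (\<Sum>i = 1..n. l i)"

definition mbdf :: "nat \<Rightarrow> (nat \<Rightarrow> nat) \<Rightarrow> (cat_vertex \<Rightarrow> int) \<Rightarrow> bool" where
  "mbdf n l f \<longleftrightarrow>
     bdf (caterpillar n l) f \<and>
     (\<forall>i \<in> {1..n}. l i \<noteq> 1 \<longrightarrow> f (Spine i) \<in> {-1, 1})"

end

theory Submission
  imports Defs
begin

text \<open>Each leaf condition forces \<open>f\<close> on the leaves of \<open>a\<^sub>i\<close> to be \<open>- x\<^sub>i\<close>, where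
  \<open>x\<^sub>i = f a\<^sub>i\<close>, so the spine condition reads \<open>x\<^sub>i\<^sub>-\<^sub>1 + x\<^sub>i\<^sub>+\<^sub>1 = (l\<^sub>i - 1) x\<^sub>i\<close> with
  \<open>x\<^sub>0 = x\<^sub>n\<^sub>+\<^sub>1 = 0\<close>. As \<open>l\<^sub>i = 1\<close> whenever \<open>x\<^sub>i = 0\<close>, multiplying by \<open>x\<^sub>i\<close> and summing gives
  \<open>L - n = 2 S\<close> with \<open>S\<close> the sum of the products \<open>x\<^sub>i x\<^sub>i\<^sub>+\<^sub>1\<close> for \<open>0 \<le> i \<le> n\<close>. By the recurrence
  two consecutive zeros would make \<open>x\<close> vanish everywhere, so
  \<open>(1 - x\<^sub>i\<^sup>2) (1 - x\<^sub>i\<^sub>+\<^sub>1\<^sup>2) = 0\<close>; hence \<open>x\<^sub>i x\<^sub>i\<^sub>+\<^sub>1\<close> has the parity of \<open>x\<^sub>i\<^sup>2 + x\<^sub>i\<^sub>+\<^sub>1\<^sup>2 - 1\<close>, and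
  \<open>S\<close> has the parity of \<open>n + 1\<close>.\<close>

text \<open>Run forwards or backwards, the recurrence carries a pair of adjacent zeros to the next
  pair, whatever \<open>c\<close> is.\<close>

lemma consecutive_zeros_iff:
  fixes x c :: "nat \<Rightarrow> int"
  assumes rec: "\<And>i. i < n \<Longrightarrow> x i + x (i + 2) = c (i + 1) * x (i + 1)"
    and "i \<le> n"
  shows "x i = 0 \<and> x (i + 1) = 0 \<longleftrightarrow> x 0 = 0 \<and> x 1 = 0"
  using \<open>i \<le> n\<close>
proof (induction i)
  case (Suc i)
  then show ?case using rec[of i] by auto
qed simp

text \<open>Each product of neighbours is counted once from either end; the boundary terms supply
  the missing copies.\<close>

lemma sum_mult_neighbours:
  fixes x :: "nat \<Rightarrow> int"
  shows "(\<Sum>i<n. x (i + 1) * (x i + x (i + 2))) + x 0 * x 1 + x n * x (n + 1)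
    = 2 * (\<Sum>i\<le>n. x i * x (i + 1))"
  by (induction n) (simp_all add: algebra_simps)

lemma sum_add_shift:
  fixes g :: "nat \<Rightarrow> int"
  shows "(\<Sum>i\<le>n. g i + g (i + 1)) = 2 * (\<Sum>i\<le>n. g i) - g 0 + g (n + 1)"
  by (induction n) simp_all

lemma recurrence_sum_cong:
  fixes x c :: "nat \<Rightarrow> int"
  assumes rec: "\<And>i. i < n \<Longrightarrow> x i + x (i + 2) = c (i + 1) * x (i + 1)"
    and x0: "x 0 = 0" and xn: "x (n + 1) = 0"
    and x: "\<And>i. x i \<in> {-1, 0, 1}"
    and c: "\<And>i. i < n \<Longrightarrow> x (i + 1) = 0 \<Longrightarrow> c (i + 1) = 0"
    and k: "k \<le> n" "x k \<noteq> 0"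
  shows "[(\<Sum>i<n. c (i + 1)) = 2 * int n + 2] (mod 4)"
proof -
  let ?S = "\<Sum>i\<le>n. x i * x (i + 1)"
  have nz: "x i \<noteq> 0 \<or> x (i + 1) \<noteq> 0" if "i \<le> n" for i
  proof (rule ccontr)
    assume "\<not> ?thesis"
    then have "x 0 = 0 \<and> x 1 = 0"
      using consecutive_zeros_iff[where x = x and c = c, OF rec that] by simp
    then have "x k = 0"
      using consecutive_zeros_iff[where x = x and c = c, OF rec k(1)] by simp
    with k(2) show False by simp
  qed
  \<comment> \<open>If \<open>x (i + 1)\<close> is nonzero, its square is 1; otherwise
    \<open>c (i + 1)\<close> is 0.\<close>
  have "c (i + 1) = x (i + 1) * (x i + x (i + 2))" if "i < n" for i
    using rec[OF that] c[OF that] x[of "i + 1"] by auto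
  then have sum_c: "(\<Sum>i<n. c (i + 1)) = 2 * ?S"
    using sum_mult_neighbours[of x n] x0 xn by simp
  have "even (x i * x (i + 1) - ((x i)\<^sup>2 + (x (i + 1))\<^sup>2 - 1))" if "i \<le> n" for i
    using nz[OF that] x[of i] x[of "i + 1"] by auto
  then have "even (\<Sum>i\<le>n. x i * x (i + 1) - ((x i)\<^sup>2 + (x (i + 1))\<^sup>2 - 1))"
    by (intro dvd_sum) auto
  also have "(\<Sum>i\<le>n. x i * x (i + 1) - ((x i)\<^sup>2 + (x (i + 1))\<^sup>2 - 1))
      = ?S - 2 * (\<Sum>i\<le>n. (x i)\<^sup>2) + (int n + 1)"
    using sum_add_shift[of "\<lambda>i. (x i)\<^sup>2" n] x0 xn by (simp add: sum_subtractf)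
  finally have "even (?S - (int n + 1))"
    by simp
  then show ?thesis
    unfolding sum_c cong_iff_dvd_diff by (elim evenE) (auto simp: algebra_simps)
qed

lemma closed_nbhd_caterpillar_Pendant:
  assumes "i \<in> {1..n}" "j \<in> {1..l i}"
  shows "closed_nbhd (caterpillar n l) (Pendant i j) = {Spine i, Pendant i j}"
  using assms by (auto simp: closed_nbhd_def caterpillar_def Let_def)

text \<open>The intersection drops the missing neighbours at the ends of the spine.\<close>

lemma closed_nbhd_caterpillar_Spine:
  assumes "i \<in> {1..n}"
  shows "closed_nbhd (caterpillar n l) (Spine i)
    = Spine ` ({i - 1, i, i + 1} \<inter> {1..n}) \<union> Pendant i ` {1..l i}"
  using assms by (auto simp: closed_nbhd_def caterpillar_def Let_def)

lemma bdf_caterpillar_Pendant: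
  assumes "bdf (caterpillar n l) f" "i \<in> {1..n}" "j \<in> {1..l i}"
  shows "f (Pendant i j) = - f (Spine i)"
proof -
  have "Pendant i j \<in> pverts (caterpillar n l)"
    using assms by (simp add: caterpillar_def Let_def)
  then have "(\<Sum>u \<in> {Spine i, Pendant i j}. f u) = 0"
    using assms closed_nbhd_caterpillar_Pendant unfolding bdf_def by metis
  then show ?thesis by simp
qed

lemma bdf_caterpillar_Spine:
  assumes "bdf (caterpillar n l) f" "i \<in> {1..n}"
  shows "(\<Sum>k \<in> {i - 1, i, i + 1} \<inter> {1..n}. f (Spine k)) = int (l i) * f (Spine i)"
proof -
  have "Spine i \<in> pverts (caterpillar n l)"
    using assms by (simp add: caterpillar_def Let_def)
  then have "0 = (\<Sum>u \<in> Spine ` ({i - 1, i, i + 1} \<inter> {1..n}) \<union> Pendant i ` {1..l i}. f u)"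
    using assms closed_nbhd_caterpillar_Spine unfolding bdf_def by metis
  also have "\<dots> = (\<Sum>k \<in> {i - 1, i, i + 1} \<inter> {1..n}. f (Spine k)) + (\<Sum>j=1..l i. f (Pendant i j))"
    by (subst sum.union_disjoint) (auto simp: sum.reindex inj_on_def)
  also have "(\<Sum>j=1..l i. f (Pendant i j)) = - (int (l i) * f (Spine i))"
    using bdf_caterpillar_Pendant[OF assms] by simp
  finally show ?thesis by simp
qed

theorem theorem6:
  fixes n :: nat and l :: "nat \<Rightarrow> nat" and f :: "cat_vertex \<Rightarrow> int"
  assumes "n \<ge> 2"
    and "mbdf n l f"
    and "\<exists>v \<in> pverts (caterpillar n l). f v \<noteq> 0"
  shows "[int (num_leaves n l) = 3 * int n - 2] (mod 4)"
proof -
  have bdf: "bdf (caterpillar n l) f"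
    and l: "\<And>i. i \<in> {1..n} \<Longrightarrow> l i \<noteq> 1 \<Longrightarrow> f (Spine i) \<in> {-1, 1}"
    using assms(2) by (auto simp: mbdf_def)
  define x where "x i = (if i \<in> {1..n} then f (Spine i) else 0)" for i
  \<comment> \<open>A nonzero leaf has a nonzero spine neighbour.\<close>
  obtain k where k: "k \<in> {1..n}" "f (Spine k) \<noteq> 0"
    using assms(3) bdf_caterpillar_Pendant[OF bdf]
    by (fastforce simp: caterpillar_def Let_def)
  have "[(\<Sum>i<n. int (l (i + 1)) - 1) = 2 * int n + 2] (mod 4)"
  proof (rule recurrence_sum_cong[where x = x and c = "\<lambda>i. int (l i) - 1" and k = k])
    fix i assume "i < n"
    then have i: "i + 1 \<in> {1..n}" by simp
    have "int (l (i + 1)) * x (i + 1) = (\<Sum>k \<in> {i, i + 1, i + 2} \<inter> {1..n}. f (Spine k))"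
      using bdf_caterpillar_Spine[OF bdf i] i by (simp add: x_def)
    also have "\<dots> = (\<Sum>k \<in> {i, i + 1, i + 2}. x k)"
      unfolding x_def by (rule sum.inter_restrict) simp
    finally show "x i + x (i + 2) = (int (l (i + 1)) - 1) * x (i + 1)"
      by (simp add: algebra_simps)
    show "int (l (i + 1)) - 1 = 0" if "x (i + 1) = 0"
      using that i l[OF i] by (auto simp: x_def)
  next
    show "x i \<in> {-1, 0, 1}" for i
      using bdf by (auto simp: x_def bdf_def caterpillar_def Let_def)
  qed (use k in \<open>auto simp: x_def\<close>)
  moreover have "(\<Sum>i<n. int (l (i + 1)) - 1) = int (num_leaves n l) - int n"
    by (simp add: num_leaves_def sum_subtractf sum.atLeast1_atMost_eq)
  ultimately have "4 dvd int (num_leaves n l) - int n - (2 * int n + 2)"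
    by (simp add: cong_iff_dvd_diff)
  \<comment> \<open>Adding 4 turns the constant -2 into the +2 of the goal.\<close>
  then have "4 dvd int (num_leaves n l) - int n - (2 * int n + 2) + 4"
    by (simp only: dvd_add_triv_right_iff)
  then show ?thesis
    by (simp add: cong_iff_dvd_diff algebra_simps)
qed

end
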